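(* The set of edge apex graphs is not closed under taking minors; that is, there exist a graph $G$ that is edge apex and a minor of $G$ that is not edge apex.
   Context: Graphs are finite, simple and undirected. $G-e$ is the graph obtained by deleting the edge $e$. A graph $H$ is a minor of $G$ if $H$ can be obtained by contracting edges in a subgraph of $G$ (after a contraction, doubled edges are replaced by a single edge so that the graph stays simple). A graph $G$ is edge apex if there is an edge $e\in E(G)$ such that $G-e$ is planar; every planar graph (including graphs with no edges) is counted as edge apex. *)

theory Defs
  imports "HOL-Analysis.Analysis"
begin

record 'a ugraph =
  verts :: "'a set"
  edges :: "'a set set"

definition simple_graph :: "'a ugraph \<Rightarrow> bool" where
  "simple_graph G \<longleftrightarrow>
     finite (verts G) \<and> (\<forall>e\<in>edges G. e \<subseteq> verts G \<and> card e = 2)"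

definition delete_edge :: "'a ugraph \<Rightarrow> 'a set \<Rightarrow> 'a ugraph" where
  "delete_edge G e = \<lparr>verts = verts G, edges = edges G - {e}\<rparr>"

definition subgraph :: "'a ugraph \<Rightarrow> 'a ugraph \<Rightarrow> bool" where
  "subgraph S G \<longleftrightarrow> simple_graph S \<and> verts S \<subseteq> verts G \<and> edges S \<subseteq> edges G"

text \<open>Contracting the edge \<open>{u, v}\<close> merges \<open>v\<close> into \<open>u\<close>, which keeps its name. Doubled
  edges coincide because the edges form a set; \<open>{u}\<close> is the image of the contracted edge.\<close>

definition contract_edge :: "'a \<Rightarrow> 'a \<Rightarrow> 'a ugraph \<Rightarrow> 'a ugraph" where
  "contract_edge u v G =
     \<lparr>verts = verts G - {v},
      edges = (\<lambda>e. (\<lambda>x. if x = v then u else x) ` e) ` edges G - {{u}}\<rparr>"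

definition contracts_to :: "'a ugraph \<Rightarrow> 'a ugraph \<Rightarrow> bool" where
  "contracts_to G H \<longleftrightarrow> (\<exists>u v. {u, v} \<in> edges G \<and> H = contract_edge u v G)"

definition graph_iso :: "'a ugraph \<Rightarrow> 'b ugraph \<Rightarrow> bool" where
  "graph_iso G H \<longleftrightarrow>
     (\<exists>f. bij_betw f (verts G) (verts H) \<and> edges H = (\<lambda>e. f ` e) ` edges G)"

text \<open>Minors are taken up to isomorphism, so they do not depend on which of its two ends
  names a contracted edge.\<close>

definition minor_of :: "'b ugraph \<Rightarrow> 'a ugraph \<Rightarrow> bool" where
  "minor_of H G \<longleftrightarrow>
     (\<exists>S K. subgraph S G \<and> contracts_to\<^sup>*\<^sup>* S K \<and> graph_iso K H)"

text \<open>The plane is \<^typ>\<open>complex\<close>, as in the Jordan curve theorem of the library. Vertices are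
  drawn as distinct points and edges as arcs (injective paths) between their ends; an arc meets
  no other vertex, and two arcs meet only at common ends.\<close>

definition plane_drawing ::
  "'a ugraph \<Rightarrow> ('a \<Rightarrow> complex) \<Rightarrow> ('a set \<Rightarrow> real \<Rightarrow> complex) \<Rightarrow> bool" where
  "plane_drawing G p \<gamma> \<longleftrightarrow>
     inj_on p (verts G) \<and>
     (\<forall>e\<in>edges G. arc (\<gamma> e) \<and> {pathstart (\<gamma> e), pathfinish (\<gamma> e)} = p ` e \<and>
        path_image (\<gamma> e) \<inter> p ` verts G = p ` e) \<and>
     (\<forall>e\<in>edges G. \<forall>e'\<in>edges G. e \<noteq> e' \<longrightarrow>
        path_image (\<gamma> e) \<inter> path_image (\<gamma> e') \<subseteq> p ` (e \<inter> e'))"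

definition planar :: "'a ugraph \<Rightarrow> bool" where
  "planar G \<longleftrightarrow> (\<exists>p \<gamma>. plane_drawing G p \<gamma>)"

definition edge_apex :: "'a ugraph \<Rightarrow> bool" where
  "edge_apex G \<longleftrightarrow> planar G \<or> (\<exists>e\<in>edges G. planar (delete_edge G e))"

end

theory Submission imports Defs begin

text \<open>Deleting an edge from \<open>K\<^sub>3\<^sub>,\<^sub>4\<close> leaves a copy of \<open>K\<^sub>3\<^sub>,\<^sub>3\<close>, so \<open>K\<^sub>3\<^sub>,\<^sub>4\<close> is not edge
  apex. Splitting a vertex of degree 4 into the ends of a new edge, each end taking two of the
  four neighbours, gives a graph that becomes planar when the new edge is deleted and becomes
  \<open>K\<^sub>3\<^sub>,\<^sub>4\<close> when it is contracted.\<close>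

section \<open>Arcs as point sets\<close>

text \<open>Forgetting the parametrization lets an edge be traversed in either direction, as going
  round a cycle requires.\<close>

definition arc_between :: "complex \<Rightarrow> complex \<Rightarrow> complex set \<Rightarrow> bool" where
  "arc_between x y S \<longleftrightarrow>
     (\<exists>g. arc g \<and> pathstart g = x \<and> pathfinish g = y \<and> path_image g = S)"

lemma arc_between_sym: "arc_between x y S \<Longrightarrow> arc_between y x S"
  unfolding arc_between_def
  by (metis arc_reversepath path_image_reversepath pathfinish_reversepath pathstart_reversepath)

lemma arc_between_join:
  assumes "arc_between x y S" "arc_between y z T" "S \<inter> T \<subseteq> {y}"
  shows "arc_between x z (S \<union> T)"
proof -
  obtain g h where "arc g" "pathstart g = x" "pathfinish g = y" "path_image g = S"
    "arc h" "pathstart h = y" "pathfinish h = z" "path_image h = T"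
    using assms unfolding arc_between_def by auto
  then show ?thesis
    unfolding arc_between_def using assms(3)
    by (intro exI[of _ "g +++ h"]) (auto intro!: arc_join simp: path_image_join)
qed

lemma arc_between_compact: "arc_between x y S \<Longrightarrow> compact S"
  and arc_between_connected: "arc_between x y S \<Longrightarrow> connected S"
  and arc_between_ends: "arc_between x y S \<Longrightarrow> x \<in> S \<and> y \<in> S"
  unfolding arc_between_def
  by (auto simp: compact_arc_image connected_arc_image)

text \<open>The arc without its ends is the image of an open interval under an injective path: it
  stays connected, and continuity at 0 and 1 puts both ends in its closure. These facts make it a
  possible \<open>F\<close> in \<open>crossing_chords\<close>.\<close>

lemma arc_between_endless:
  assumes "arc_between x y S"
  shows "connected (S - {x, y})" "S - {x, y} \<noteq> {}"
    "x \<in> closure (S - {x, y})" "y \<in> closure (S - {x, y})"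
proof -
  obtain g where g: "arc g" "pathstart g = x" "pathfinish g = y" "path_image g = S"
    using assms unfolding arc_between_def by blast
  then have sg: "simple_path g" by (simp add: arc_imp_simple_path)
  have eq: "S - {x, y} = g ` {0<..<1}"
    using simple_path_endless[OF sg] g by simp
  show "connected (S - {x, y})"
    using connected_simple_path_endless[OF sg] g by simp
  show "S - {x, y} \<noteq> {}" unfolding eq by simp
  have "g ` closure {0<..<1} \<subseteq> closure (g ` {0<..<1})"
    using arc_imp_path[OF g(1)]
    by (intro image_closure_subset) (auto simp: path_def closure_subset)
  then have "g ` {0..1} \<subseteq> closure (S - {x, y})"
    unfolding eq by simp
  then show "x \<in> closure (S - {x, y})" "y \<in> closure (S - {x, y})"
    using g by (auto simp: pathstart_def pathfinish_def)
qed

section \<open>Crossing chords of a closed curve\<close>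

text \<open>A common limit point \<open>u\<close> can be added to both connected sets, which then
  meet there. This is how a path slips from one side of a curve to the other through a single point
  of it.\<close>

lemma connected_component_via_closures:
  assumes "connected S" "connected T" "u \<in> closure S" "u \<in> closure T"
    "S \<subseteq> U" "T \<subseteq> U" "u \<in> U" "p \<in> S" "q \<in> T"
  shows "connected_component U p q"
proof -
  have "connected (insert u S)" "connected (insert u T)"
    using assms(1-4) closure_subset[of S] closure_subset[of T]
    by (auto intro: connected_intermediate_closure[of S "insert u S"]
        connected_intermediate_closure[of T "insert u T"])
  then have "connected (insert u S \<union> insert u T)"
    by (intro connected_Un) auto
  then show ?thesis
    unfolding connected_component_def using assms
    by (intro exI[of _ "insert u S \<union> insert u T"]) auto
qed

text \<open>\<open>P1 \<union> E\<close> and \<open>P2 \<union> E\<close> are the two cycles into which the chord \<open>E\<close> cuts the curve. A point of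
  the second chord \<open>F\<close> and a point of \<open>D'\<close> are joined around \<open>u\<close> off one of them and around \<open>v\<close> off
  the other, so Janiszewski's theorem joins them off the whole curve.\<close>

lemma crossing_chords:
  fixes P1 P2 E F D D' :: "complex set"
  assumes "compact P1" "compact P2" "compact E" "connected E" "P1 \<inter> P2 \<subseteq> E"
    and D: "open D" "open D'" "connected D'" "D \<inter> D' = {}" "D \<union> D' = - (P1 \<union> P2)" "D' \<noteq> {}"
    and fr: "P1 \<union> P2 \<subseteq> closure D'"
    and E: "E \<subseteq> D \<union> P1 \<union> P2"
    and F: "connected F" "F \<subseteq> D" "F \<inter> E = {}" "F \<noteq> {}" "u \<in> closure F" "v \<in> closure F"
    and u: "u \<in> P1" "u \<notin> P2" "u \<notin> E"
    and v: "v \<in> P2" "v \<notin> P1" "v \<notin> E"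
  shows False
proof -
  obtain p q where p: "p \<in> F" and q: "q \<in> D'" using F D by blast
  have off_E: "D' \<inter> E = {}" using E D by blast
  \<comment> \<open>Janiszewski's theorem asks for a connected intersection of the two sets; here it
    is the chord itself.\<close>
  have "(P1 \<union> E) \<inter> (P2 \<union> E) = E" using assms(5) by blast
  moreover have "connected_component (- (P1 \<union> E)) p q"
    by (rule connected_component_via_closures[where S = F and T = D' and u = v])
      (use D F v fr off_E p q in auto)
  moreover have "connected_component (- (P2 \<union> E)) p q"
    by (rule connected_component_via_closures[where S = F and T = D' and u = u])
      (use D F u fr off_E p q in auto)
  ultimately have "connected_component (- ((P1 \<union> E) \<union> (P2 \<union> E))) p q"
    using assms(1-4) by (intro Janiszewski[of "P1 \<union> E" "P2 \<union> E"])
      (simp_all add: compact_Un compact_imp_closed del: Compl_Un)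
  then have "connected_component (D \<union> D') p q"
    by (rule connected_component_of_subset) (use D in blast)
  then obtain T where T: "connected T" "T \<subseteq> D \<union> D'" "p \<in> T" "q \<in> T"
    unfolding connected_component_def by blast
  then show False
    using connectedD[OF T(1) D(1) D(2)] D(4) p q F by blast
qed

section \<open>The graph K33 cannot be drawn in the plane\<close>

text \<open>Vertices are their own positions and edges are point sets, so the topological argument
  is free of abstract graphs. That an arc misses the other four vertices follows from the last
  clause, because each of them is an end of further arcs.\<close>

definition K33_drawing where
  "K33_drawing a0 a1 a2 b0 b1 b2 E \<longleftrightarrow>
     distinct [a0, a1, a2, b0, b1, b2] \<and>
     (\<forall>x\<in>{a0, a1, a2}. \<forall>y\<in>{b0, b1, b2}. arc_between x y (E x y)) \<and>
     (\<forall>x\<in>{a0, a1, a2}. \<forall>y\<in>{b0, b1, b2}. \<forall>x'\<in>{a0, a1, a2}. \<forall>y'\<in>{b0, b1, b2}.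
        (x, y) \<noteq> (x', y') \<longrightarrow> E x y \<inter> E x' y' \<subseteq> {x, y} \<inter> {x', y'})"

text \<open>Rotating both triples shifts the hexagon by two corners and permutes its three long
  chords cyclically, so one chord and one pair of chords represent all.\<close>

lemma K33_drawing_rotate:
  "K33_drawing a0 a1 a2 b0 b1 b2 E \<Longrightarrow> K33_drawing a1 a2 a0 b1 b2 b0 E"
proof -
  have "{a1, a2, a0} = {a0, a1, a2}" "{b1, b2, b0} = {b0, b1, b2}" by auto
  moreover have "distinct [a1, a2, a0, b1, b2, b0] \<longleftrightarrow> distinct [a0, a1, a2, b0, b1, b2]" by auto
  ultimately show "K33_drawing a0 a1 a2 b0 b1 b2 E \<Longrightarrow> K33_drawing a1 a2 a0 b1 b2 b0 E"
    unfolding K33_drawing_def by simp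
qed

text \<open>The cycle a0 b0 a1 b1 a2 b2, bracketed into its two halves between \<open>a0\<close> and
  \<open>b1\<close>. The three remaining arcs are the long chords, which join opposite
  corners.\<close>

definition hexagon where
  "hexagon a0 a1 a2 b0 b1 b2 E =
     (E a0 b0 \<union> E a1 b0 \<union> E a1 b1) \<union> (E a2 b1 \<union> E a2 b2 \<union> E a0 b2)"

lemma hexagon_rotate: "hexagon a1 a2 a0 b1 b2 b0 E = hexagon a0 a1 a2 b0 b1 b2 E"
  unfolding hexagon_def by auto

context
  fixes a0 a1 a2 b0 b1 b2 :: complex and E
  assumes K33: "K33_drawing a0 a1 a2 b0 b1 b2 E"
begin

private lemma distinct_vertices: "distinct [a0, a1, a2, b0, b1, b2]"
  using K33 unfolding K33_drawing_def by blast

private lemma arcs: "x \<in> {a0, a1, a2} \<Longrightarrow> y \<in> {b0, b1, b2} \<Longrightarrow> arc_between x y (E x y)"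
  using K33 unfolding K33_drawing_def by blast

text \<open>No vertex lies on both sides of the bipartition, so an end shared by two arcs occupies
  the same position in both index pairs.\<close>

private lemma inter:
  assumes "z \<in> E x y" "z \<in> E x' y'" "x \<in> {a0, a1, a2}" "y \<in> {b0, b1, b2}"
    "x' \<in> {a0, a1, a2}" "y' \<in> {b0, b1, b2}" "\<not> (x = x' \<and> y = y')"
  shows "x = x' \<and> z = x \<or> y = y' \<and> z = y"
proof -
  have "E x y \<inter> E x' y' \<subseteq> {x, y} \<inter> {x', y'}"
    using K33 assms(3-7) unfolding K33_drawing_def by blast
  then have "z \<in> {x, y} \<inter> {x', y'}" using assms(1,2) by blast
  moreover have "x \<noteq> y'" "y \<noteq> x'"
    using assms(3-6) distinct_vertices by auto
  ultimately show ?thesis by auto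
qed

private lemma arcs': "x \<in> {a0, a1, a2} \<Longrightarrow> y \<in> {b0, b1, b2} \<Longrightarrow> arc_between y x (E x y)"
  using arcs arc_between_sym by blast

private lemma half1: "arc_between a0 b1 (E a0 b0 \<union> E a1 b0 \<union> E a1 b1)"
proof (intro arc_between_join)
  show "arc_between a0 b0 (E a0 b0)" "arc_between b0 a1 (E a1 b0)" "arc_between a1 b1 (E a1 b1)"
    by (intro arcs arcs'; simp)+
  show "E a0 b0 \<inter> E a1 b0 \<subseteq> {b0}" "(E a0 b0 \<union> E a1 b0) \<inter> E a1 b1 \<subseteq> {a1}"
    by (intro subsetI, elim IntE UnE; (drule (1) inter; use distinct_vertices in auto))+
qed

private lemma half2: "arc_between b1 a0 (E a2 b1 \<union> E a2 b2 \<union> E a0 b2)"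
proof (intro arc_between_join)
  show "arc_between b1 a2 (E a2 b1)" "arc_between a2 b2 (E a2 b2)" "arc_between b2 a0 (E a0 b2)"
    by (intro arcs arcs'; simp)+
  show "E a2 b1 \<inter> E a2 b2 \<subseteq> {a2}" "(E a2 b1 \<union> E a2 b2) \<inter> E a0 b2 \<subseteq> {b2}"
    by (intro subsetI, elim IntE UnE; (drule (1) inter; use distinct_vertices in auto))+
qed

private lemma halves_inter:
  "(E a0 b0 \<union> E a1 b0 \<union> E a1 b1) \<inter> (E a2 b1 \<union> E a2 b2 \<union> E a0 b2) \<subseteq> {a0, b1}"
  by (intro subsetI, elim IntE UnE; (drule (1) inter; use distinct_vertices in auto))

text \<open>The two halves are arcs meeting only at their ends, so they form a simple closed curve.
  The Jordan curve theorem makes this curve the frontier of both components, hence part of both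
  closures.\<close>

lemma hexagon_Jordan:
  obtains D D' where "connected D" "connected D'" "open D" "open D'" "D \<noteq> {}" "D' \<noteq> {}"
    "D \<inter> D' = {}" "D \<union> D' = - hexagon a0 a1 a2 b0 b1 b2 E"
    "hexagon a0 a1 a2 b0 b1 b2 E \<subseteq> closure D" "hexagon a0 a1 a2 b0 b1 b2 E \<subseteq> closure D'"
proof -
  obtain g h where gh: "arc g" "pathstart g = a0" "pathfinish g = b1"
      "path_image g = E a0 b0 \<union> E a1 b0 \<union> E a1 b1"
    "arc h" "pathstart h = b1" "pathfinish h = a0"
      "path_image h = E a2 b1 \<union> E a2 b2 \<union> E a0 b2"
    using half1 half2 unfolding arc_between_def by auto
  have "simple_path (g +++ h)"
    using gh halves_inter by (intro simple_path_join_loop) auto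
  moreover have "pathfinish (g +++ h) = pathstart (g +++ h)" using gh by simp
  moreover have "path_image (g +++ h) = hexagon a0 a1 a2 b0 b1 b2 E"
    using gh by (simp add: path_image_join hexagon_def)
  ultimately show thesis
    using Jordan_curve[of "g +++ h"] that by (metis frontier_def Diff_subset)
qed

lemma chord_off_hexagon: "(E a0 b1 - {a0, b1}) \<inter> hexagon a0 a1 a2 b0 b1 b2 E = {}"
  unfolding hexagon_def
  by (intro equals0I, elim IntE DiffE UnE; (drule (1) inter; use distinct_vertices in auto))

lemma chord_in_component:
  assumes "open D" "open D'" "D \<inter> D' = {}" "D \<union> D' = - hexagon a0 a1 a2 b0 b1 b2 E"
  shows "E a0 b1 - {a0, b1} \<subseteq> D \<or> E a0 b1 - {a0, b1} \<subseteq> D'"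
proof -
  have "connected (E a0 b1 - {a0, b1})"
    using arc_between_endless(1) arcs by blast
  from connectedD[OF this assms(1,2)] show ?thesis
    using chord_off_hexagon assms(3,4) by blast
qed

text \<open>The first chord cuts the hexagon at the ends of its two halves, and the second runs from
  \<open>a1\<close> on one half to \<open>b2\<close> on the other. These two corners act as
  \<open>u\<close> and \<open>v\<close> in \<open>crossing_chords\<close>.\<close>

lemma chords_in_same_component:
  assumes "connected D'" "open D" "open D'" "D' \<noteq> {}"
    "D \<inter> D' = {}" "D \<union> D' = - hexagon a0 a1 a2 b0 b1 b2 E"
    "hexagon a0 a1 a2 b0 b1 b2 E \<subseteq> closure D'"
    and chord1: "E a0 b1 - {a0, b1} \<subseteq> D" and chord2: "E a1 b2 - {a1, b2} \<subseteq> D"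
  shows False
proof (rule crossing_chords)
  let ?P1 = "E a0 b0 \<union> E a1 b0 \<union> E a1 b1" and ?P2 = "E a2 b1 \<union> E a2 b2 \<union> E a0 b2"
  have ends: "x \<in> E x y \<and> y \<in> E x y" if "x \<in> {a0, a1, a2}" "y \<in> {b0, b1, b2}" for x y
    using arcs[OF that] by (rule arc_between_ends)
  have chord: "arc_between a1 b2 (E a1 b2)" "arc_between a0 b1 (E a0 b1)"
    using arcs by blast+
  show "compact ?P1" "compact ?P2" "compact (E a0 b1)" "connected (E a0 b1)"
    using half1 half2 chord arc_between_compact arc_between_connected by blast+
  show "?P1 \<inter> ?P2 \<subseteq> E a0 b1" using halves_inter ends[of a0 b1] by blast
  show "open D" "open D'" "connected D'" "D \<inter> D' = {}" "D' \<noteq> {}" by fact+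
  show "D \<union> D' = - (?P1 \<union> ?P2)" "?P1 \<union> ?P2 \<subseteq> closure D'"
    using assms unfolding hexagon_def by auto
  show "E a0 b1 \<subseteq> D \<union> ?P1 \<union> ?P2"
    using chord1 ends[of a0 b0] ends[of a1 b1] by blast
  show "connected (E a1 b2 - {a1, b2})" "E a1 b2 - {a1, b2} \<noteq> {}"
    "a1 \<in> closure (E a1 b2 - {a1, b2})" "b2 \<in> closure (E a1 b2 - {a1, b2})"
    using arc_between_endless[OF chord(1)] by blast+
  show "E a1 b2 - {a1, b2} \<subseteq> D" by fact
  show "(E a1 b2 - {a1, b2}) \<inter> E a0 b1 = {}"
    by (intro equals0I, elim IntE DiffE; (drule (1) inter; use distinct_vertices in auto))
  show "a1 \<in> ?P1" "b2 \<in> ?P2" using ends[of a1 b1] ends[of a2 b2] by auto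
  \<comment> \<open>The arc \<open>E a1 y\<close> contains \<open>a1\<close> and may meet
    \<open>E x y\<close> only in \<open>y\<close>.\<close>
  have "a1 \<notin> E x y" if "x \<in> {a0, a2}" "y \<in> {b0, b1, b2}" for x y
    using inter[of a1 a1 y x y] ends[of a1 y] that distinct_vertices by auto
  then show "a1 \<notin> ?P2" "a1 \<notin> E a0 b1" by simp_all
  have "b2 \<notin> E x y" if "x \<in> {a0, a1, a2}" "y \<in> {b0, b1}" for x y
    using inter[of b2 x b2 x y] ends[of x b2] that distinct_vertices by auto
  then show "b2 \<notin> ?P1" "b2 \<notin> E a0 b1" by simp_all
qed

end

text \<open>By pigeonhole, two of the three long chords of the hexagon lie in the same component.\<close>

lemma no_K33_drawing: "\<not> K33_drawing a0 a1 a2 b0 b1 b2 E"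
proof
  assume K: "K33_drawing a0 a1 a2 b0 b1 b2 E"
  note K' = K33_drawing_rotate[OF K]
  note K'' = K33_drawing_rotate[OF K']
  \<comment> \<open>All rotated hexagons are the same curve, so a single pair \<open>D\<close>,
    \<open>D'\<close> serves all three chords.\<close>
  note rot = hexagon_rotate[of a1 a2 a0 b1 b2 b0 E] hexagon_rotate[of a0 a1 a2 b0 b1 b2 E]
  obtain D D' where D: "connected D" "connected D'" "open D" "open D'" "D \<noteq> {}" "D' \<noteq> {}"
    "D \<inter> D' = {}" "D \<union> D' = - hexagon a0 a1 a2 b0 b1 b2 E"
    "hexagon a0 a1 a2 b0 b1 b2 E \<subseteq> closure D" "hexagon a0 a1 a2 b0 b1 b2 E \<subseteq> closure D'"
    using hexagon_Jordan[OF K] .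
  have D_swap: "D' \<inter> D = {}" "D' \<union> D = - hexagon a0 a1 a2 b0 b1 b2 E"
    using D by auto
  have same: "\<not> (E a0 b1 - {a0, b1} \<subseteq> C \<and> E a1 b2 - {a1, b2} \<subseteq> C)"
    "\<not> (E a1 b2 - {a1, b2} \<subseteq> C \<and> E a2 b0 - {a2, b0} \<subseteq> C)"
    "\<not> (E a2 b0 - {a2, b0} \<subseteq> C \<and> E a0 b1 - {a0, b1} \<subseteq> C)" if "C \<in> {D, D'}" for C
    using that chords_in_same_component[OF K, of D' D] chords_in_same_component[OF K, of D D']
      chords_in_same_component[OF K', of D' D] chords_in_same_component[OF K', of D D']
      chords_in_same_component[OF K'', of D' D] chords_in_same_component[OF K'', of D D']
      D D_swap
    unfolding rot by auto
  show False
    using chord_in_component[OF K, of D D'] chord_in_component[OF K', of D D']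
      chord_in_component[OF K'', of D D'] D same[of D] same[of D']
    unfolding rot by auto
qed

section \<open>Nonplanarity of graphs containing K33\<close>

text \<open>A drawing fixes the ends of a path only as a set; symmetry of \<open>arc_between\<close>
  covers both orientations.\<close>

lemma plane_drawing_arc_between:
  assumes "plane_drawing G p \<gamma>" "{x, y} \<in> edges G"
  shows "arc_between (p x) (p y) (path_image (\<gamma> {x, y}))"
proof -
  have g: "arc (\<gamma> {x, y})" "{pathstart (\<gamma> {x, y}), pathfinish (\<gamma> {x, y})} = {p x, p y}"
    using assms unfolding plane_drawing_def by auto
  then have "arc_between (pathstart (\<gamma> {x, y})) (pathfinish (\<gamma> {x, y})) (path_image (\<gamma> {x, y}))"
    unfolding arc_between_def by blast
  with g(2) show ?thesis
    by (metis arc_between_sym doubleton_eq_iff)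
qed

lemma not_planar_if_K33:
  assumes "distinct [a0, a1, a2, b0, b1, b2]"
    and V: "{a0, a1, a2, b0, b1, b2} \<subseteq> verts G"
    and edges: "\<And>x y. x \<in> {a0, a1, a2} \<Longrightarrow> y \<in> {b0, b1, b2} \<Longrightarrow> {x, y} \<in> edges G"
  shows "\<not> planar G"
proof
  assume "planar G"
  then obtain p \<gamma> where d: "plane_drawing G p \<gamma>" unfolding planar_def by blast
  then have inj: "inj_on p (verts G)"
    and cross: "\<And>e e'. e \<in> edges G \<Longrightarrow> e' \<in> edges G \<Longrightarrow> e \<noteq> e' \<Longrightarrow>
      path_image (\<gamma> e) \<inter> path_image (\<gamma> e') \<subseteq> p ` (e \<inter> e')"
    unfolding plane_drawing_def by blast+
  \<comment> \<open>Arcs of a \<open>K33_drawing\<close> are indexed by points but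
    \<open>\<gamma>\<close> by edges; \<open>q\<close> leads from points back to vertex
    names.\<close>
  define q where "q = inv_into (verts G) p"
  have q: "q (p x) = x" if "x \<in> {a0, a1, a2, b0, b1, b2}" for x
    unfolding q_def using inj V that by (intro inv_into_f_f) auto
  have "set [a0, a1, a2, b0, b1, b2] \<subseteq> verts G" using V by simp
  then have distinct: "distinct (map p [a0, a1, a2, b0, b1, b2])"
    unfolding distinct_map using assms(1) inj_on_subset[OF inj] by blast
  have cross': "path_image (\<gamma> {x, y}) \<inter> path_image (\<gamma> {x', y'}) \<subseteq> {p x, p y} \<inter> {p x', p y'}"
    if "x \<in> {a0, a1, a2}" "y \<in> {b0, b1, b2}" "x' \<in> {a0, a1, a2}" "y' \<in> {b0, b1, b2}"
      "(x, y) \<noteq> (x', y')" for x y x' y'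
  proof -
    \<comment> \<open>Disjointness of the two sides turns distinct ordered pairs into distinct
      unordered edges.\<close>
    have "x \<noteq> y'" using that(1,4) assms(1) by auto
    then have "{x, y} \<noteq> {x', y'}" using that(5) by (simp add: doubleton_eq_iff)
    then have "path_image (\<gamma> {x, y}) \<inter> path_image (\<gamma> {x', y'}) \<subseteq> p ` ({x, y} \<inter> {x', y'})"
      by (rule cross[OF edges[OF that(1,2)] edges[OF that(3,4)]])
    then show ?thesis by blast
  qed
  have "K33_drawing (p a0) (p a1) (p a2) (p b0) (p b1) (p b2)
      (\<lambda>x y. path_image (\<gamma> {q x, q y}))"
    unfolding K33_drawing_def
  proof (intro conjI ballI impI)
    show "distinct [p a0, p a1, p a2, p b0, p b1, p b2]" using distinct by simp
  next
    fix x y assume "x \<in> {p a0, p a1, p a2}" "y \<in> {p b0, p b1, p b2}"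
    then obtain x0 y0 where "x0 \<in> {a0, a1, a2}" "x = p x0" "y0 \<in> {b0, b1, b2}" "y = p y0"
      by blast
    moreover from this have "q x = x0" "q y = y0" using q by auto
    ultimately show "arc_between x y (path_image (\<gamma> {q x, q y}))"
      using plane_drawing_arc_between[OF d edges, of x0 y0] by simp
  next
    fix x y x' y' assume "x \<in> {p a0, p a1, p a2}" "y \<in> {p b0, p b1, p b2}"
      "x' \<in> {p a0, p a1, p a2}" "y' \<in> {p b0, p b1, p b2}" and ne: "(x, y) \<noteq> (x', y')"
    then obtain x0 y0 x1 y1 where *: "x0 \<in> {a0, a1, a2}" "x = p x0" "y0 \<in> {b0, b1, b2}" "y = p y0"
      "x1 \<in> {a0, a1, a2}" "x' = p x1" "y1 \<in> {b0, b1, b2}" "y' = p y1"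
      by blast
    then have "q x = x0" "q y = y0" "q x' = x1" "q y' = y1" using q by auto
    moreover have "(x0, y0) \<noteq> (x1, y1)" using *(2,4,6,8) ne by blast
    ultimately show "path_image (\<gamma> {q x, q y}) \<inter> path_image (\<gamma> {q x', q y'}) \<subseteq> {x, y} \<inter> {x', y'}"
      using cross'[OF *(1,3,5,7)] *(2,4,6,8) by simp
  qed
  then show False using no_K33_drawing by blast
qed

section \<open>The graph K34 is not edge apex\<close>

definition K34 :: "nat ugraph" where
  "K34 = \<lparr>verts = {0..<7}, edges = (\<Union>x\<in>{0, 1, 2}. \<Union>y\<in>{3, 4, 5, 6}. {{x, y}})\<rparr>"

lemma K34_not_edge_apex: "\<not> edge_apex K34"
proof -
  \<comment> \<open>The edge set \<open>S\<close> is left general so that the claim applies both to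
    \<open>K34\<close> and to \<open>K34\<close> with an edge deleted.\<close>
  have K33: "\<not> planar \<lparr>verts = {0..<7}, edges = S\<rparr>"
    if b: "distinct [b0, b1, b2]" "{b0, b1, b2} \<subseteq> {3, 4, 5, 6}"
      and S: "\<And>x y. x \<in> {0, 1, 2} \<Longrightarrow> y \<in> {b0, b1, b2} \<Longrightarrow> {x, y} \<in> S" for b0 b1 b2 :: nat and S
  proof (rule not_planar_if_K33)
    show "distinct [0, 1, 2, b0, b1, b2]" using b by auto
    show "{0, 1, 2, b0, b1, b2} \<subseteq> verts \<lparr>verts = {0..<7}, edges = S\<rparr>" using b(2) by auto
    show "{x, y} \<in> edges \<lparr>verts = {0..<7}, edges = S\<rparr>"
      if "x \<in> {0, 1, 2}" "y \<in> {b0, b1, b2}" for x y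
      using S[OF that] by simp
  qed
  have edge: "{x, y} \<in> edges K34" if "x \<in> {0, 1, 2}" "y \<in> {3, 4, 5, 6}" for x y
    unfolding K34_def ugraph.select_convs by (rule UN_I[OF that(1) UN_I[OF that(2)]]) simp
  have "\<not> planar (delete_edge K34 e)" if "e \<in> edges K34" for e
  proof -
    have "\<exists>x\<in>{0, 1, 2}. \<exists>y\<in>{3, 4, 5, 6}. e = {x, y}"
      using that by (simp only: K34_def ugraph.select_convs UN_iff singleton_iff)
    then obtain x y where e: "e = {x, y}" "x \<in> {0, 1, 2}" "y \<in> {3, 4, 5, 6}"
      by (elim bexE)
    \<comment> \<open>The deleted edge affects only \<open>y\<close> on the side of four; the other
      three vertices there keep all nine edges to 0, 1 and 2.\<close>
    have "\<exists>b0 b1 b2. distinct [b0, b1, b2, y] \<and> {b0, b1, b2} \<subseteq> {3, 4, 5, 6}"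
    proof -
      consider "y = 3" | "y = 4" | "y = 5" | "y = 6" using e(3) by blast
      then show ?thesis
      proof cases
        case 1 then show ?thesis by (intro exI[of _ 4] exI[of _ 5] exI[of _ 6]) simp
      next
        case 2 then show ?thesis by (intro exI[of _ 3] exI[of _ 5] exI[of _ 6]) simp
      next
        case 3 then show ?thesis by (intro exI[of _ 3] exI[of _ 4] exI[of _ 6]) simp
      next
        case 4 then show ?thesis by (intro exI[of _ 3] exI[of _ 4] exI[of _ 5]) simp
      qed
    qed
    then obtain b0 b1 b2 where b: "distinct [b0, b1, b2, y]" "{b0, b1, b2} \<subseteq> {3, 4, 5, 6}"
      by blast
    have "{x', y'} \<in> edges K34 - {e}" if "x' \<in> {0, 1, 2}" "y' \<in> {b0, b1, b2}" for x' y'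
    proof -
      have "y' \<in> {3, 4, 5, 6}" using that(2) b(2) by (rule subsetD[rotated])
      moreover have "y \<notin> {x', y'}" using that b(1) e(3) by auto
      then have "{x', y'} \<noteq> e" unfolding e(1) by blast
      ultimately show ?thesis using edge[OF that(1)] by blast
    qed
    then have "\<not> planar \<lparr>verts = {0..<7}, edges = edges K34 - {e}\<rparr>"
      using b by (intro K33[of b0 b1 b2]) simp_all
    then show ?thesis
      unfolding delete_edge_def by (simp add: K34_def)
  qed
  moreover have "\<not> planar K34"
  proof -
    have "\<not> planar \<lparr>verts = {0..<7}, edges = edges K34\<rparr>"
      by (intro K33[of 3 4 5] edge) auto
    then show ?thesis by (simp add: K34_def)
  qed
  ultimately show ?thesis unfolding edge_apex_def by blast
qed

section \<open>Splitting a vertex of K34\<close>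

text \<open>Vertex 0 of \<open>K34\<close> is split into 0, keeping neighbours 3 and 4, and 7,
  taking 5 and 6. The joining edge \<open>{0, 7}\<close> is kept apart because this set is what has
  to be drawn.\<close>

definition split_edges :: "nat set set" where
  "split_edges = {{0, 3}, {0, 4}, {7, 5}, {7, 6},
     {1, 3}, {1, 4}, {1, 5}, {1, 6}, {2, 3}, {2, 4}, {2, 5}, {2, 6}}"

definition split_K34 :: "nat ugraph" where
  "split_K34 = \<lparr>verts = {0..<8}, edges = insert {0, 7} split_edges\<rparr>"

lemma contract_split_K34: "contract_edge 0 7 split_K34 = K34"
proof (intro ugraph.equality)
  \<comment> \<open>The extra \<open>{0}\<close> is the image of the contracted edge, which
    \<open>contract_edge\<close> discards.\<close>
  have "(\<lambda>e. (\<lambda>x. if x = 7 then 0 else x) ` e) ` edges split_K34 = insert {0} (edges K34)"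
    by (simp add: split_K34_def split_edges_def K34_def insert_commute)
  moreover have "{0} \<notin> edges K34"
    by (simp add: K34_def)
  ultimately show "edges (contract_edge 0 7 split_K34) = edges K34"
    unfolding contract_edge_def by (simp only: ugraph.select_convs Diff_insert_absorb not_False_eq_True)
  show "verts (contract_edge 0 7 split_K34) = verts K34"
    unfolding contract_edge_def split_K34_def K34_def by auto
qed (simp add: contract_edge_def K34_def)

section \<open>A straight-line drawing of the split graph without the new edge\<close>

text \<open>Vertices 1 and 2 sit above and below the real axis, which carries 3, 0, 4, 5, 7, 6 from
  left to right. Thus 0 and 7 lie between their own neighbours, and 1 and 2 reach 3, 4, 5, 6 by two
  fans of segments.\<close>

definition split_pos :: "nat \<Rightarrow> complex" where
  "split_pos n = [Complex (-2) 0, Complex 0 3, Complex 0 (-3), Complex (-3) 0, Complex (-1) 0,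
     Complex 1 0, Complex 3 0, Complex 2 0] ! n"

text \<open>Multiplying the line equation and the bounds by \<open>s\<close> lets one statement
  serve the upper fan, \<open>s = 3\<close>, and the lower fan, \<open>s = -3\<close>.\<close>

lemma closed_segment_slanted:
  "closed_segment (Complex 0 s) (Complex c 0) \<subseteq>
     {z. s * Re z = c * (s - Im z) \<and> 0 \<le> s * Im z \<and> s * Im z \<le> s * s}"
proof
  fix z assume "z \<in> closed_segment (Complex 0 s) (Complex c 0)"
  then obtain u where u: "0 \<le> u" "u \<le> 1" "Re z = u * c" "Im z = (1 - u) * s"
    by (auto simp: in_segment)
  have *: "s * Im z = (1 - u) * (s * s)" using u by simp
  have "s * Re z = c * (s - Im z)"
    unfolding u(3,4) by (simp add: algebra_simps)
  moreover have "0 \<le> (1 - u) * (s * s)" using u by simp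
  moreover have "(1 - u) * (s * s) \<le> 1 * (s * s)" using u by (intro mult_right_mono) auto
  ultimately show "z \<in> {z. s * Re z = c * (s - Im z) \<and> 0 \<le> s * Im z \<and> s * Im z \<le> s * s}"
    unfolding mem_Collect_eq * by simp
qed

lemma closed_segment_real_axis:
  assumes "a \<le> b"
  shows "closed_segment (Complex a 0) (Complex b 0) \<subseteq> {z. Im z = 0 \<and> a \<le> Re z \<and> Re z \<le> b}"
proof
  fix z assume "z \<in> closed_segment (Complex a 0) (Complex b 0)"
  then obtain u where u: "0 \<le> u" "u \<le> 1" "Re z = a + u * (b - a)" "Im z = 0"
    by (auto simp: in_segment intro!: that) (simp add: algebra_simps)
  moreover have "0 \<le> u * (b - a)" "u * (b - a) \<le> 1 * (b - a)"
    using u(1,2) assms by (simp, intro mult_right_mono) auto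
  ultimately show "z \<in> {z. Im z = 0 \<and> a \<le> Re z \<and> Re z \<le> b}" by simp
qed

lemma planar_split_edges: "planar \<lparr>verts = {0..<8}, edges = split_edges\<rparr>"
proof -
  \<comment> \<open>Ordering the ends by name makes the path depend on the edge alone. As 1 and 2
    are smaller than all their neighbours, slanted segments start at the apex of their fan.\<close>
  define \<gamma> where "\<gamma> e = linepath (split_pos (Min e)) (split_pos (Max e))" for e
  have pos: "split_pos 0 = Complex (-2) 0" "split_pos 1 = Complex 0 3"
    "split_pos (Suc 0) = Complex 0 3"
    "split_pos 2 = Complex 0 (-3)" "split_pos 3 = Complex (-3) 0" "split_pos 4 = Complex (-1) 0"
    "split_pos 5 = Complex 1 0" "split_pos 6 = Complex 3 0" "split_pos 7 = Complex 2 0"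
    by (simp_all add: split_pos_def)
  have verts: "{0..<8} = {0, 1, 2, 3, 4, 5, 6, 7 :: nat}" by auto
  have inj: "inj_on split_pos {0..<8}"
    unfolding verts by (simp add: pos)
  have ends: "arc (\<gamma> e) \<and> {pathstart (\<gamma> e), pathfinish (\<gamma> e)} = split_pos ` e"
    if "e \<in> split_edges" for e
    using that unfolding split_edges_def \<gamma>_def by (auto simp: pos intro!: arc_linepath)
  have upper: "3 * Re z = c * (3 - Im z) \<and> 0 \<le> Im z \<and> Im z \<le> 3"
    if "z \<in> closed_segment (Complex 0 3) (Complex c 0)" for z c
    using subsetD[OF closed_segment_slanted that] by simp
  have lower: "3 * Re z = c * (3 + Im z) \<and> - 3 \<le> Im z \<and> Im z \<le> 0"
    if "z \<in> closed_segment (Complex 0 (-3)) (Complex c 0)" for z c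
    using subsetD[OF closed_segment_slanted that] by (simp add: algebra_simps)
  have middle: "Im z = 0 \<and> min a b \<le> Re z \<and> Re z \<le> max a b"
    if "z \<in> closed_segment (Complex a 0) (Complex b 0)" for z a b
    using closed_segment_real_axis[of a b] closed_segment_real_axis[of b a] that
    by (cases "a \<le> b") (auto simp: closed_segment_commute)
  have image: "path_image (\<gamma> e) = closed_segment (split_pos (Min e)) (split_pos (Max e))" for e
    by (simp add: \<gamma>_def)
  \<comment> \<open>Each edge is confined by linear conditions, so that checking every edge against
    every vertex and every other edge becomes linear arithmetic.\<close>
  have bounds:
    "z \<in> path_image (\<gamma> {0, 3}) \<Longrightarrow> Im z = 0 \<and> - 3 \<le> Re z \<and> Re z \<le> - 2"
    "z \<in> path_image (\<gamma> {0, 4}) \<Longrightarrow> Im z = 0 \<and> - 2 \<le> Re z \<and> Re z \<le> - 1"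
    "z \<in> path_image (\<gamma> {7, 5}) \<Longrightarrow> Im z = 0 \<and> 1 \<le> Re z \<and> Re z \<le> 2"
    "z \<in> path_image (\<gamma> {7, 6}) \<Longrightarrow> Im z = 0 \<and> 2 \<le> Re z \<and> Re z \<le> 3"
    "z \<in> path_image (\<gamma> {1, 3}) \<Longrightarrow> 3 * Re z = - 3 * (3 - Im z) \<and> 0 \<le> Im z \<and> Im z \<le> 3"
    "z \<in> path_image (\<gamma> {1, 4}) \<Longrightarrow> 3 * Re z = - 1 * (3 - Im z) \<and> 0 \<le> Im z \<and> Im z \<le> 3"
    "z \<in> path_image (\<gamma> {1, 5}) \<Longrightarrow> 3 * Re z = 1 * (3 - Im z) \<and> 0 \<le> Im z \<and> Im z \<le> 3"
    "z \<in> path_image (\<gamma> {1, 6}) \<Longrightarrow> 3 * Re z = 3 * (3 - Im z) \<and> 0 \<le> Im z \<and> Im z \<le> 3"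
    "z \<in> path_image (\<gamma> {2, 3}) \<Longrightarrow> 3 * Re z = - 3 * (3 + Im z) \<and> - 3 \<le> Im z \<and> Im z \<le> 0"
    "z \<in> path_image (\<gamma> {2, 4}) \<Longrightarrow> 3 * Re z = - 1 * (3 + Im z) \<and> - 3 \<le> Im z \<and> Im z \<le> 0"
    "z \<in> path_image (\<gamma> {2, 5}) \<Longrightarrow> 3 * Re z = 1 * (3 + Im z) \<and> - 3 \<le> Im z \<and> Im z \<le> 0"
    "z \<in> path_image (\<gamma> {2, 6}) \<Longrightarrow> 3 * Re z = 3 * (3 + Im z) \<and> - 3 \<le> Im z \<and> Im z \<le> 0" for z
    using upper[of z "-3"] upper[of z "-1"] upper[of z 1] upper[of z 3]
      lower[of z "-3"] lower[of z "-1"] lower[of z 1] lower[of z 3]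
      middle[of z "-2" "-3"] middle[of z "-2" "-1"] middle[of z 1 2] middle[of z 3 2]
    by (simp_all add: image pos)
  have verts_off: "x \<in> e"
    if "e \<in> split_edges" "x \<in> {0..<8}" "split_pos x \<in> path_image (\<gamma> e)" for e x
    using that unfolding split_edges_def verts
    by (elim insertE emptyE, simp_all only: simp_thms) (drule bounds, simp add: pos)+
  have cross: "z \<in> split_pos ` (e \<inter> e')"
    if "e \<in> split_edges" "e' \<in> split_edges" "e \<noteq> e'"
      "z \<in> path_image (\<gamma> e)" "z \<in> path_image (\<gamma> e')" for e e' z
    using that unfolding split_edges_def
    by (elim insertE emptyE, simp_all only: simp_thms)
      (drule bounds, drule bounds, (auto simp: pos complex_eq_iff)[1])+
  show ?thesis
    unfolding planar_def plane_drawing_def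
  proof (intro exI[of _ split_pos] exI[of _ \<gamma>] conjI ballI impI, simp_all only: ugraph.simps)
    show "inj_on split_pos {0..<8}" by (rule inj)
    fix e assume e: "e \<in> split_edges"
    then show "arc (\<gamma> e)" "{pathstart (\<gamma> e), pathfinish (\<gamma> e)} = split_pos ` e"
      using ends by auto
    have "e \<subseteq> {0..<8}" using e unfolding split_edges_def by auto
    moreover have "split_pos ` e \<subseteq> path_image (\<gamma> e)"
      using ends[OF e] by (metis insert_subset pathfinish_in_path_image pathstart_in_path_image empty_subsetI)
    ultimately show "path_image (\<gamma> e) \<inter> split_pos ` {0..<8} = split_pos ` e"
      using verts_off[OF e] by blast
    fix e' assume "e' \<in> split_edges" "e \<noteq> e'"
    then show "path_image (\<gamma> e) \<inter> path_image (\<gamma> e') \<subseteq> split_pos ` (e \<inter> e')"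
      using cross e by blast
  qed
qed

theorem theorem5p2:
  "\<exists>(G :: nat ugraph) (H :: nat ugraph).
     simple_graph G \<and> simple_graph H \<and> edge_apex G \<and> minor_of H G \<and> \<not> edge_apex H"
proof (intro exI conjI)
  show simple: "simple_graph split_K34"
    unfolding simple_graph_def split_K34_def split_edges_def by auto
  show "simple_graph K34"
    unfolding simple_graph_def K34_def by auto
  have "delete_edge split_K34 {0, 7} = \<lparr>verts = {0..<8}, edges = split_edges\<rparr>"
    unfolding delete_edge_def split_K34_def split_edges_def by (auto simp: doubleton_eq_iff)
  then show "edge_apex split_K34"
    unfolding edge_apex_def using planar_split_edges
    by (intro disjI2 bexI[of _ "{0, 7}"]) (simp_all add: split_K34_def)
  have "contracts_to split_K34 K34"
    unfolding contracts_to_def using contract_split_K34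
    by (intro exI[of _ 0] exI[of _ 7]) (simp add: split_K34_def)
  \<comment> \<open>Contraction yields \<open>K34\<close> with its very vertex names, so the
    identity suffices, and the subgraph is the whole graph.\<close>
  moreover have "graph_iso K34 K34"
    unfolding graph_iso_def by (intro exI[of _ id]) auto
  ultimately show "minor_of K34 split_K34"
    unfolding minor_of_def subgraph_def using simple by blast
  show "\<not> edge_apex K34" by (rule K34_not_edge_apex)
qed

end
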